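(* Let $(\mathbf X,\mathbf v,\mathbf w):U\to\mathbb R^3_1\times\Delta_4$ be a lightcone framed surface with basic invariants $a_i,b_i,c_i,e_i,f_i,g_i$ $(i=1,2)$, normalized so that $a_2=b_2=0$, and let $p\in U$ be a lightlike point of $\mathbf X$ (with $a_1(p)=0$, $b_1(p)\neq0$, $c_2(p)\ne 0$). Subscripts $u,v$ after the index denote partial derivatives. (1) Suppose $p$ is non-degenerate; then $a_1(p)=0$ and $(a_{1u}^2+a_{1v}^2)(p)\neq 0$. Moreover: (a) $\mathbf X$ at $p$ is $\mathcal A$-equivalent to the cuspidal-edge-kind if and only if $(a_{1v}c_1-a_{1u}c_2)(p)\neq 0$; (b) $\mathbf X$ at $p$ is $\mathcal A$-equivalent to the swallowtail-kind if and only if $(a_{1v}c_1-a_{1u}c_2)(p)=0$ and $$\bigl(c_2(a_{1v}c_{1u}-a_{1uu}c_2-a_{1u}c_{2u}+a_{1uv}c_1)-c_1(a_{1vv}c_1+a_{1v}c_{1v}-a_{1u}c_{2v}-a_{1uv}c_2)\bigr)(p)\neq 0;$$ (c) $\mathbf X$ at $p$ is $\mathcal A$-equivalent to the cuspidal-butterfly-kind if and only if $$(a_{1v}c_1-a_{1u}c_2)(p)=\bigl(c_2(a_{1v}c_{1u}-a_{1uu}c_2-a_{1u}c_{2u}+a_{1uv}c_1)-c_1(a_{1vv}c_1+a_{1v}c_{1v}-a_{1u}c_{2v}-a_{1uv}c_2)\bigr)(p)=0$$ and $$\begin{aligned} \bigl(&(c_2c_{2u}-c_1c_{2v})(a_{1v}c_{1u}-a_{1uu}c_2-a_{1u}c_{2u}+a_{1uv}c_1)\\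 &+(c_1c_{1v}-c_2c_{1u})(a_{1vv}c_1+a_{1v}c_{1v}-a_{1u}c_{2v}-a_{1uv}c_2)\\ &+c_2^2(2a_{1uv}c_{1u}+a_{1v}c_{1uu}-a_{1uuu}c_2-2a_{1uu}c_{2u}-a_{1u}c_{2uu}+a_{1uuv}c_1)\\ &+c_1^2(a_{1vvv}c_1+2a_{1vv}c_{1v}+a_{1v}c_{1vv}-2a_{1uv}c_{2v}-a_{1u}c_{2vv}-a_{1uvv}c_2)\\ &-2c_1c_2(a_{1uvv}c_1+a_{1vv}c_{1u}+a_{1uv}c_{1v}+a_{1v}c_{1uv}-a_{1uu}c_{2v}-a_{1u}c_{2uv}-a_{1uuv}c_2-a_{1uv}c_{2u})\bigr)(p)\neq 0. \end{aligned}$$ (2) Suppose $p$ is degenerate; then $a_1(p)=a_{1u}(p)=a_{1v}(p)=0$. Moreover: (a) $\mathbf X$ at $p$ is $\mathcal A$-equivalent to the cuspidal-lips-kind if and only if $(a_{1uu}a_{1vv}-a_{1uv}^2)(p)>0$; (b) $\mathbf X$ at $p$ is $\mathcal A$-equivalent to the cuspidal-beaks-kind if and only if $(a_{1uu}a_{1vv}-a_{1uv}^2)(p)<0$ and $(2a_{1uv}c_1c_2-a_{1uu}c_2^2-a_{1vv}c_1^2)(p)\neq 0$.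
   Context: All maps are $C^\infty$. $\mathbb R^3_1$ is $\mathbb R^3$ with $\langle \mathbf x,\mathbf y\rangle=-x_1y_1+x_2y_2+x_3y_3$. The product $\mathbf x\wedge\mathbf y$ is the vector with $\langle\mathbf z,\mathbf x\wedge\mathbf y\rangle=\det(\mathbf z,\mathbf x,\mathbf y)$ for all $\mathbf z$. A nonzero vector is lightlike if $\langle\mathbf x,\mathbf x\rangle=0$. $LC^*=\{\mathbf x\ne0:\langle\mathbf x,\mathbf x\rangle=0\}$ and $\Delta_4=\{(\mathbf v,\mathbf w)\in LC^*\times LC^*:\langle\mathbf v,\mathbf w\rangle=-2\}$. $U\subset\mathbb R^2$ is a connected domain with coordinates $(u,v)$. A smooth map $(\mathbf X,\mathbf v,\mathbf w):U\to\mathbb R^3_1\times\Delta_4$ is a lightcone framed surface if $\mathbf X_u\wedge\mathbf X_v=\alpha\mathbf v+\beta\mathbf w$ for some smooth functions $\alpha,\beta:U\to\mathbb R$. Put $\mathbf m=-\tfrac12\mathbf v\wedge\mathbf w$ (so $\langle\mathbf m,\mathbf m\rangle=1$). The basic invariants are the smooth functions defined by $$\mathbf X_u=a_1\mathbf v+b_1\mathbf w+c_1\mathbf m,\quad \mathbf X_v=a_2\mathbf v+b_2\mathbf w+c_2\mathbf m,$$ and, with $i=1$ for $\partial_u$ and $i=2$ for $\partial_v$: $\partial_i\mathbf v=e_i\mathbf v+2g_i\mathbf m$, $\partial_i\mathbf w=-e_i\mathbf w+2f_i\mathbf m$, $\partial_i\mathbf m=f_i\mathbf v+g_i\mathbf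 w$. Standing normalization: $a_2=b_2=0$ on $U$; then $\mathbf X_u\wedge\mathbf X_v=-a_1c_2\mathbf v+b_1c_2\mathbf w$. A point $p$ is a lightlike point of $\mathbf X$ if the vector $\mathbf X_u\wedge\mathbf X_v$ is lightlike (in particular nonzero) at $p$; by convention it is of the type $a_1(p)=0$, $b_1(p)\neq0$, $c_2(p)\neq0$. Let $E=\langle\mathbf X_u,\mathbf X_u\rangle$, $F=\langle\mathbf X_u,\mathbf X_v\rangle$, $G=\langle\mathbf X_v,\mathbf X_v\rangle$ and $\lambda=EG-F^2$. A lightlike point $p$ is non-degenerate if $d\lambda(p)\neq0$ and degenerate if $d\lambda(p)=0$. Let $\tilde\lambda=-4a_1b_1$ be the signed area density function (so $\lambda=c_2^2\tilde\lambda$), and let $\eta=c_2\partial_u-c_1\partial_v$, a vector field on $U$ which is a null vector at lightlike points. Write $\eta\tilde\lambda$ for the derivative of $\tilde\lambda$ along $\eta$, and $\eta\eta\tilde\lambda$, $\eta\eta\eta\tilde\lambda$ for iterates. Let $\mathcal H_{\tilde\lambda}$ be the Hessian matrix of $\tilde\lambda$ in $(u,v)$. The kinds of lightlike points are defined by transferring the criteria for singular points of wave fronts to the pair $(\tilde\lambda,\eta)$. At a non-degenerate lightlike point $p$, $\mathbf X$ is said to be $\mathcal A$-equivalent to the - cuspidal-edge-kind if $\eta\tilde\lambda(p)\ne0$; - swallowtail-kind if $\eta\tilde\lambda(p)=0$, $\eta\eta\tilde\lambda(p)\neq0$; - cuspidal-butterfly-kind if $\eta\tilde\lambda(p)=\eta\eta\tilde\lambda(p)=0$,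 $\eta\eta\eta\tilde\lambda(p)\neq0$. At a degenerate lightlike point $p$ it is said to be $\mathcal A$-equivalent to the - cuspidal-lips-kind if $\det\mathcal H_{\tilde\lambda}(p)>0$; - cuspidal-beaks-kind if $\det\mathcal H_{\tilde\lambda}(p)<0$ and $\eta\eta\tilde\lambda(p)\neq0$. *)

theory Defs
  imports "HOL-Analysis.Analysis"
begin

section \<open>Smooth maps and derivatives\<close>

text \<open>The iterated Frechet derivatives of order at most \<open>n\<close> exist and are continuous on the
  (open) set \<open>U\<close>.\<close>

primrec differentiable_of_order ::
  "nat \<Rightarrow> ('a::real_normed_vector \<Rightarrow> 'b::real_normed_vector) \<Rightarrow> 'a set \<Rightarrow> bool" where
  "differentiable_of_order 0 f U \<longleftrightarrow> continuous_on U f"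
| "differentiable_of_order (Suc n) f U \<longleftrightarrow>
     (\<forall>x\<in>U. f differentiable (at x)) \<and>
     (\<forall>h. differentiable_of_order n (\<lambda>x. frechet_derivative f (at x) h) U)"

definition smooth_on ::
  "'a::real_normed_vector set \<Rightarrow> ('a \<Rightarrow> 'b::real_normed_vector) \<Rightarrow> bool" where
  "smooth_on U f \<longleftrightarrow> (\<forall>n. differentiable_of_order n f U)"

text \<open>The coordinates \<open>u\<close> and \<open>v\<close> of the plane have the indices \<open>1\<close> and \<open>2\<close>.\<close>

definition partial :: "2 \<Rightarrow> (real^2 \<Rightarrow> 'b::real_normed_vector) \<Rightarrow> real^2 \<Rightarrow> 'b" where
  "partial i f p = frechet_derivative f (at p) (axis i 1)"

text \<open>Subscripts are read from left to right: \<open>f\<close> with index \<open>uv\<close> is \<open>f\<close> differentiated first by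
  \<open>u\<close> and then by \<open>v\<close>.\<close>

abbreviation sub_u ("_\<^bsub>u\<^esub>" [1000] 1000) where "f\<^bsub>u\<^esub> \<equiv> partial 1 f"
abbreviation sub_v ("_\<^bsub>v\<^esub>" [1000] 1000) where "f\<^bsub>v\<^esub> \<equiv> partial 2 f"
abbreviation sub_uu ("_\<^bsub>uu\<^esub>" [1000] 1000) where "f\<^bsub>uu\<^esub> \<equiv> partial 1 (partial 1 f)"
abbreviation sub_uv ("_\<^bsub>uv\<^esub>" [1000] 1000) where "f\<^bsub>uv\<^esub> \<equiv> partial 2 (partial 1 f)"
abbreviation sub_vv ("_\<^bsub>vv\<^esub>" [1000] 1000) where "f\<^bsub>vv\<^esub> \<equiv> partial 2 (partial 2 f)"
abbreviation sub_uuu ("_\<^bsub>uuu\<^esub>" [1000] 1000) where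
  "f\<^bsub>uuu\<^esub> \<equiv> partial 1 (partial 1 (partial 1 f))"
abbreviation sub_uuv ("_\<^bsub>uuv\<^esub>" [1000] 1000) where
  "f\<^bsub>uuv\<^esub> \<equiv> partial 2 (partial 1 (partial 1 f))"
abbreviation sub_uvv ("_\<^bsub>uvv\<^esub>" [1000] 1000) where
  "f\<^bsub>uvv\<^esub> \<equiv> partial 2 (partial 2 (partial 1 f))"
abbreviation sub_vvv ("_\<^bsub>vvv\<^esub>" [1000] 1000) where
  "f\<^bsub>vvv\<^esub> \<equiv> partial 2 (partial 2 (partial 2 f))"

definition along :: "(real^2 \<Rightarrow> real^2) \<Rightarrow> (real^2 \<Rightarrow> real) \<Rightarrow> real^2 \<Rightarrow> real" where
  "along \<eta> f p = frechet_derivative f (at p) (\<eta> p)"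

definition hessian :: "(real^2 \<Rightarrow> real) \<Rightarrow> real^2 \<Rightarrow> real^2^2" where
  "hessian f p = (\<chi> i j. partial j (partial i f) p)"

section \<open>Lorentz-Minkowski 3-space\<close>

definition lprod :: "real^3 \<Rightarrow> real^3 \<Rightarrow> real" where
  "lprod x y = - x$1 * y$1 + x$2 * y$2 + x$3 * y$3"

definition wedge :: "real^3 \<Rightarrow> real^3 \<Rightarrow> real^3" where
  "wedge x y = (THE t. \<forall>z. lprod z t = det (vector [z, x, y] :: real^3^3))"

lemma wedge_unique_existence:
  "\<exists>!t. \<forall>z. lprod z t = det (vector [z, x, y] :: real^3^3)"
proof (rule ex1I)
  show "\<forall>z. lprod z (vector [x$3 * y$2 - x$2 * y$3, x$3 * y$1 - x$1 * y$3,
      x$1 * y$2 - x$2 * y$1]) = det (vector [z, x, y] :: real^3^3)"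
    by (simp add: lprod_def det_3 algebra_simps)
next
  fix t assume t: "\<forall>z. lprod z t = det (vector [z, x, y] :: real^3^3)"
  show "t = vector [x$3 * y$2 - x$2 * y$3, x$3 * y$1 - x$1 * y$3, x$1 * y$2 - x$2 * y$1]"
    using t[rule_format, of "vector [1,0,0]"] t[rule_format, of "vector [0,1,0]"]
      t[rule_format, of "vector [0,0,1]"]
    by (simp add: lprod_def det_3 vec_eq_iff forall_3 algebra_simps)
qed

lemma lprod_wedge: "lprod z (wedge x y) = det (vector [z, x, y] :: real^3^3)"
  using theI'[OF wedge_unique_existence[of x y]] unfolding wedge_def by blast

definition lightlike :: "real^3 \<Rightarrow> bool" where
  "lightlike x \<longleftrightarrow> x \<noteq> 0 \<and> lprod x x = 0"

definition LC :: "(real^3) set" where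
  "LC = {x. lightlike x}"

definition Delta4 :: "((real^3) \<times> (real^3)) set" where
  "Delta4 = {(v, w) \<in> LC \<times> LC. lprod v w = - 2}"

section \<open>Lightcone framed surfaces\<close>

definition lightcone_framed_surface ::
  "(real^2) set \<Rightarrow> (real^2 \<Rightarrow> real^3) \<Rightarrow> (real^2 \<Rightarrow> real^3) \<Rightarrow> (real^2 \<Rightarrow> real^3) \<Rightarrow> bool" where
  "lightcone_framed_surface U X v w \<longleftrightarrow>
     smooth_on U X \<and> smooth_on U v \<and> smooth_on U w \<and>
     (\<forall>q\<in>U. (v q, w q) \<in> Delta4) \<and>
     (\<exists>\<alpha> \<beta> :: real^2 \<Rightarrow> real. smooth_on U \<alpha> \<and> smooth_on U \<beta> \<and>
        (\<forall>q\<in>U. wedge (partial 1 X q) (partial 2 X q) = \<alpha> q *\<^sub>R v q + \<beta> q *\<^sub>R w q))"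

definition unit_m :: "(real^2 \<Rightarrow> real^3) \<Rightarrow> (real^2 \<Rightarrow> real^3) \<Rightarrow> real^2 \<Rightarrow> real^3" where
  "unit_m v w q = - (1/2) *\<^sub>R wedge (v q) (w q)"

text \<open>The invariants belonging to the \<open>i\<close>-th coordinate direction. The frame \<open>v, w, m\<close> is a basis
  at each point, so they are uniquely determined on \<open>U\<close>.\<close>

definition basic_invariants ::
  "(real^2) set \<Rightarrow> (real^2 \<Rightarrow> real^3) \<Rightarrow> (real^2 \<Rightarrow> real^3) \<Rightarrow> (real^2 \<Rightarrow> real^3) \<Rightarrow> 2 \<Rightarrow>
   (real^2 \<Rightarrow> real) \<Rightarrow> (real^2 \<Rightarrow> real) \<Rightarrow> (real^2 \<Rightarrow> real) \<Rightarrow>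
   (real^2 \<Rightarrow> real) \<Rightarrow> (real^2 \<Rightarrow> real) \<Rightarrow> (real^2 \<Rightarrow> real) \<Rightarrow> bool" where
  "basic_invariants U X v w i a b c e f g \<longleftrightarrow>
     smooth_on U a \<and> smooth_on U b \<and> smooth_on U c \<and>
     smooth_on U e \<and> smooth_on U f \<and> smooth_on U g \<and>
     (\<forall>q\<in>U.
        partial i X q = a q *\<^sub>R v q + b q *\<^sub>R w q + c q *\<^sub>R unit_m v w q \<and>
        partial i v q = e q *\<^sub>R v q + (2 * g q) *\<^sub>R unit_m v w q \<and>
        partial i w q = - e q *\<^sub>R w q + (2 * f q) *\<^sub>R unit_m v w q \<and>
        partial i (unit_m v w) q = f q *\<^sub>R v q + g q *\<^sub>R w q)"

section \<open>Lightlike points and their kinds\<close>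

definition lightlike_point :: "(real^2 \<Rightarrow> real^3) \<Rightarrow> real^2 \<Rightarrow> bool" where
  "lightlike_point X p \<longleftrightarrow> lightlike (wedge (partial 1 X p) (partial 2 X p))"

definition fundE :: "(real^2 \<Rightarrow> real^3) \<Rightarrow> real^2 \<Rightarrow> real" where
  "fundE X q = lprod (partial 1 X q) (partial 1 X q)"

definition fundF :: "(real^2 \<Rightarrow> real^3) \<Rightarrow> real^2 \<Rightarrow> real" where
  "fundF X q = lprod (partial 1 X q) (partial 2 X q)"

definition fundG :: "(real^2 \<Rightarrow> real^3) \<Rightarrow> real^2 \<Rightarrow> real" where
  "fundG X q = lprod (partial 2 X q) (partial 2 X q)"

definition discriminant :: "(real^2 \<Rightarrow> real^3) \<Rightarrow> real^2 \<Rightarrow> real" where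
  "discriminant X q = fundE X q * fundG X q - (fundF X q)\<^sup>2"

definition nondegenerate_lightlike_point :: "(real^2 \<Rightarrow> real^3) \<Rightarrow> real^2 \<Rightarrow> bool" where
  "nondegenerate_lightlike_point X p \<longleftrightarrow>
     lightlike_point X p \<and> frechet_derivative (discriminant X) (at p) \<noteq> (\<lambda>_. 0)"

definition degenerate_lightlike_point :: "(real^2 \<Rightarrow> real^3) \<Rightarrow> real^2 \<Rightarrow> bool" where
  "degenerate_lightlike_point X p \<longleftrightarrow>
     lightlike_point X p \<and> frechet_derivative (discriminant X) (at p) = (\<lambda>_. 0)"

definition signed_area_density ::
  "(real^2 \<Rightarrow> real) \<Rightarrow> (real^2 \<Rightarrow> real) \<Rightarrow> real^2 \<Rightarrow> real" where
  "signed_area_density a1 b1 q = - 4 * a1 q * b1 q"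

definition null_field :: "(real^2 \<Rightarrow> real) \<Rightarrow> (real^2 \<Rightarrow> real) \<Rightarrow> real^2 \<Rightarrow> real^2" where
  "null_field c1 c2 q = vector [c2 q, - c1 q]"

text \<open>In the following definitions \<open>l\<close> is the signed area density function and \<open>\<eta>\<close> the null
  vector field.\<close>

definition cuspidal_edge_kind ::
  "(real^2 \<Rightarrow> real^3) \<Rightarrow> (real^2 \<Rightarrow> real) \<Rightarrow> (real^2 \<Rightarrow> real^2) \<Rightarrow> real^2 \<Rightarrow> bool" where
  "cuspidal_edge_kind X l \<eta> p \<longleftrightarrow>
     nondegenerate_lightlike_point X p \<and> along \<eta> l p \<noteq> 0"

definition swallowtail_kind ::
  "(real^2 \<Rightarrow> real^3) \<Rightarrow> (real^2 \<Rightarrow> real) \<Rightarrow> (real^2 \<Rightarrow> real^2) \<Rightarrow> real^2 \<Rightarrow> bool" where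
  "swallowtail_kind X l \<eta> p \<longleftrightarrow>
     nondegenerate_lightlike_point X p \<and> along \<eta> l p = 0 \<and> along \<eta> (along \<eta> l) p \<noteq> 0"

definition cuspidal_butterfly_kind ::
  "(real^2 \<Rightarrow> real^3) \<Rightarrow> (real^2 \<Rightarrow> real) \<Rightarrow> (real^2 \<Rightarrow> real^2) \<Rightarrow> real^2 \<Rightarrow> bool" where
  "cuspidal_butterfly_kind X l \<eta> p \<longleftrightarrow>
     nondegenerate_lightlike_point X p \<and> along \<eta> l p = 0 \<and> along \<eta> (along \<eta> l) p = 0 \<and>
     along \<eta> (along \<eta> (along \<eta> l)) p \<noteq> 0"

definition cuspidal_lips_kind ::
  "(real^2 \<Rightarrow> real^3) \<Rightarrow> (real^2 \<Rightarrow> real) \<Rightarrow> real^2 \<Rightarrow> bool" where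
  "cuspidal_lips_kind X l p \<longleftrightarrow>
     degenerate_lightlike_point X p \<and> det (hessian l p) > 0"

definition cuspidal_beaks_kind ::
  "(real^2 \<Rightarrow> real^3) \<Rightarrow> (real^2 \<Rightarrow> real) \<Rightarrow> (real^2 \<Rightarrow> real^2) \<Rightarrow> real^2 \<Rightarrow> bool" where
  "cuspidal_beaks_kind X l \<eta> p \<longleftrightarrow>
     degenerate_lightlike_point X p \<and> det (hessian l p) < 0 \<and> along \<eta> (along \<eta> l) p \<noteq> 0"

end

(* On U one has E G - F^2 = c2^2 (-4 a1 b1), where b1 and c2 do not vanish at p. Multiplication by
   a function that does not vanish at p only rescales the lowest-order nonvanishing derivative of a1
   at p, so every criterion can be read off from the derivatives of a1 alone. *)

theory Submission
  imports Defs
begin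

section \<open>Smooth functions\<close>

text \<open>The long expressions of the criteria have one source. Put phi = a_v c1 - a_u c2 with a =
  \<open>a1\<close>; then phi = -\<eta>a, and the expressions for the edge, swallowtail and
  butterfly kinds are phi, \<eta>phi and \<eta>\<eta>phi written out. The sign is harmless because
  only vanishing is asked. The expression for beaks is minus the Hessian form of a on \<eta>, which
  is what \<eta>phi becomes when a_u and a_v vanish.

  Two obstacles shape the proof. Expanding the iterates produces a_vu as well as a_uv, so equality
  of mixed derivatives has to be derived from the recursive notion of smoothness. Moreover,
  everything is controlled only on the open set \<open>U\<close>, so every formula must hold on all
  of \<open>U\<close>, and not only at \<open>p\<close>, before it may be differentiated
  again.\<close>

text \<open>\<open>frechet_derivative\<close> is a choice among the possible derivatives, and
  locally equal functions have the same ones. Hence the values agree even where no derivative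
  exists.\<close>

lemma frechet_derivative_cong_open:
  assumes "open U" "x \<in> U" "\<And>y. y \<in> U \<Longrightarrow> f y = g y"
  shows "frechet_derivative f (at x) = frechet_derivative g (at x)"
proof -
  have "(f has_derivative D) (at x) \<longleftrightarrow> (g has_derivative D) (at x)" for D
    using assms has_derivative_transform_within_open[of _ _ x UNIV U] by metis
  then show ?thesis
    by (simp add: frechet_derivative_def)
qed

text \<open>Rules for sums and products describe the derivative on \<open>U\<close> only; this lets
  the recursion continue with the function given by the rule.\<close>

lemma differentiable_of_order_cong:
  assumes "open U" "\<And>x. x \<in> U \<Longrightarrow> f x = g x" "differentiable_of_order n f U"
  shows "differentiable_of_order n g U"
  using assms(2,3)
proof (induction n arbitrary: f g)
  case 0
  then show ?case
    using continuous_on_cong by force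
next
  case (Suc n)
  have "g differentiable at x" if "x \<in> U" for x
    using Suc.prems that assms(1) has_derivative_transform_within_open
    unfolding differentiable_def by (metis differentiable_of_order.simps(2) differentiable_def)
  moreover have "differentiable_of_order n (\<lambda>x. frechet_derivative g (at x) h) U" for h
  proof (rule Suc.IH)
    show "differentiable_of_order n (\<lambda>x. frechet_derivative f (at x) h) U"
      using Suc.prems by simp
    show "frechet_derivative f (at x) h = frechet_derivative g (at x) h" if "x \<in> U" for x
      using frechet_derivative_cong_open[OF assms(1) that] Suc.prems(1) by metis
  qed
  ultimately show ?case by simp
qed

text \<open>At the bottom of the recursion this is continuity of differentiable maps. The product
  rule needs it, since it contains the factors undifferentiated.\<close>

lemma differentiable_of_order_Suc_imp:
  "differentiable_of_order (Suc n) f U \<Longrightarrow> differentiable_of_order n f U"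
proof (induction n arbitrary: f)
  case 0
  then show ?case
    by (simp add: continuous_at_imp_continuous_on differentiable_imp_continuous_within)
next
  case (Suc n)
  then show ?case
    by (metis differentiable_of_order.simps(2))
qed

lemma differentiable_of_order_add:
  assumes "open U"
  shows "differentiable_of_order n f U \<Longrightarrow> differentiable_of_order n g U \<Longrightarrow>
    differentiable_of_order n (\<lambda>x. f x + g x) U"
proof (induction n arbitrary: f g)
  case 0
  then show ?case by (simp add: continuous_on_add)
next
  case (Suc n)
  have "differentiable_of_order n (\<lambda>x. frechet_derivative (\<lambda>x. f x + g x) (at x) h) U" for h
  proof (rule differentiable_of_order_cong[OF assms])
    show "differentiable_of_order n
        (\<lambda>x. frechet_derivative f (at x) h + frechet_derivative g (at x) h) U"
      using Suc by simp
    show "frechet_derivative f (at x) h + frechet_derivative g (at x) h =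
        frechet_derivative (\<lambda>x. f x + g x) (at x) h" if "x \<in> U" for x
    proof -
      have "((\<lambda>x. f x + g x) has_derivative
          (\<lambda>h. frechet_derivative f (at x) h + frechet_derivative g (at x) h)) (at x)"
        using Suc.prems that by (auto intro!: has_derivative_add simp flip: frechet_derivative_works)
      then show ?thesis
        using frechet_derivative_at by metis
    qed
  qed
  then show ?case using Suc.prems by simp
qed

lemma has_derivative_mult_frechet:
  fixes f g :: "'a::real_normed_vector \<Rightarrow> real"
  assumes "f differentiable at x" "g differentiable at x"
  shows "((\<lambda>x. f x * g x) has_derivative
      (\<lambda>h. f x * frechet_derivative g (at x) h + frechet_derivative f (at x) h * g x)) (at x)"
  using assms by (auto intro!: has_derivative_mult simp flip: frechet_derivative_works)

lemma differentiable_of_order_mult: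
  fixes f g :: "'a::real_normed_vector \<Rightarrow> real"
  assumes "open U"
  shows "differentiable_of_order n f U \<Longrightarrow> differentiable_of_order n g U \<Longrightarrow>
    differentiable_of_order n (\<lambda>x. f x * g x) U"
proof (induction n arbitrary: f g)
  case 0
  then show ?case by (simp add: continuous_on_mult)
next
  case (Suc n)
  note order = Suc.prems[THEN differentiable_of_order_Suc_imp]
  have "differentiable_of_order n (\<lambda>x. frechet_derivative (\<lambda>x. f x * g x) (at x) h) U" for h
  proof (rule differentiable_of_order_cong[OF assms])
    show "differentiable_of_order n
        (\<lambda>x. f x * frechet_derivative g (at x) h + frechet_derivative f (at x) h * g x) U"
      using Suc order by (intro differentiable_of_order_add[OF assms] Suc.IH) auto
    show "f x * frechet_derivative g (at x) h + frechet_derivative f (at x) h * g x =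
        frechet_derivative (\<lambda>x. f x * g x) (at x) h" if "x \<in> U" for x
      using frechet_derivative_at[OF has_derivative_mult_frechet[of f x g]] Suc.prems that
      by (metis (no_types, lifting) differentiable_of_order.simps(2))
  qed
  then show ?case using Suc.prems by simp
qed

lemma differentiable_of_order_const: "differentiable_of_order n (\<lambda>_. c) U"
  by (induction n arbitrary: c) simp_all

lemma smooth_on_cong:
  assumes "open U" "\<And>x. x \<in> U \<Longrightarrow> f x = g x" "smooth_on U f"
  shows "smooth_on U g"
  using assms differentiable_of_order_cong unfolding smooth_on_def by blast

lemma smooth_on_const: "smooth_on U (\<lambda>_. c)"
  by (simp add: smooth_on_def differentiable_of_order_const)

lemma smooth_on_add:
  "open U \<Longrightarrow> smooth_on U f \<Longrightarrow> smooth_on U g \<Longrightarrow> smooth_on U (\<lambda>x. f x + g x)"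
  by (simp add: smooth_on_def differentiable_of_order_add)

lemma smooth_on_mult:
  fixes f g :: "'a::real_normed_vector \<Rightarrow> real"
  shows "open U \<Longrightarrow> smooth_on U f \<Longrightarrow> smooth_on U g \<Longrightarrow> smooth_on U (\<lambda>x. f x * g x)"
  by (simp add: smooth_on_def differentiable_of_order_mult)

lemma smooth_on_diff:
  fixes f g :: "'a::real_normed_vector \<Rightarrow> real"
  assumes "open U" "smooth_on U f" "smooth_on U g"
  shows "smooth_on U (\<lambda>x. f x - g x)"
  using smooth_on_add[OF assms(1,2) smooth_on_mult[OF assms(1) smooth_on_const[of U "-1"] assms(3)]]
  by simp

lemma smooth_on_frechet_derivative:
  "smooth_on U f \<Longrightarrow> smooth_on U (\<lambda>x. frechet_derivative f (at x) h)"
  unfolding smooth_on_def by (metis differentiable_of_order.simps(2))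

lemma smooth_on_partial: "smooth_on U f \<Longrightarrow> smooth_on U (partial i f)"
  unfolding partial_def[abs_def] by (rule smooth_on_frechet_derivative)

lemma smooth_on_imp_differentiable: "smooth_on U f \<Longrightarrow> x \<in> U \<Longrightarrow> f differentiable at x"
  unfolding smooth_on_def by (metis differentiable_of_order.simps(2))

lemma smooth_on_imp_continuous_on: "smooth_on U f \<Longrightarrow> continuous_on U f"
  unfolding smooth_on_def by (metis differentiable_of_order.simps(1))

section \<open>Symmetry of second derivatives\<close>

text \<open>Along the segment f is a function of one real variable, whose derivative is the
  directional derivative by the chain rule.\<close>

lemma mvt_direction:
  fixes f :: "'a::real_normed_vector \<Rightarrow> real"
  assumes "t > 0" and "\<And>s. 0 \<le> s \<Longrightarrow> s \<le> t \<Longrightarrow> f differentiable at (x + s *\<^sub>R h)"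
  obtains s where "0 < s" "s < t"
    "f (x + t *\<^sub>R h) - f x = t * frechet_derivative f (at (x + s *\<^sub>R h)) h"
proof -
  have "((\<lambda>s. f (x + s *\<^sub>R h)) has_derivative
      (\<lambda>d. d * frechet_derivative f (at (x + s *\<^sub>R h)) h)) (at s within {0..t})"
    if "0 \<le> s" "s \<le> t" for s
  proof -
    let ?D = "frechet_derivative f (at (x + s *\<^sub>R h))"
    have f: "(f has_derivative ?D) (at (x + s *\<^sub>R h))"
      using assms(2)[OF that] frechet_derivative_works by blast
    have "((\<lambda>s. x + s *\<^sub>R h) has_derivative (\<lambda>d. d *\<^sub>R h)) (at s within {0..t})"
      by (auto intro!: derivative_eq_intros)
    from has_derivative_compose[OF this f]
    show ?thesis
      using linear_cmul[OF has_derivative_linear[OF f]] by simp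
  qed
  from mvt_simple[OF assms(1) this]
  obtain s where "s \<in> {0<..<t}" "f (x + t *\<^sub>R h) - f (x + 0 *\<^sub>R h) =
      (t - 0) * frechet_derivative f (at (x + s *\<^sub>R h)) h"
    by blast
  then show thesis using that[of s] by simp
qed

text \<open>The mean value theorem is used twice: along \<open>h\<close> for the increment of f in
  direction \<open>k\<close>, then along \<open>k\<close> for the derivative of f in direction
  \<open>h\<close>. Only the parallelogram spanned by t h and t k has to lie in
  \<open>U\<close>.\<close>

lemma second_difference:
  fixes f :: "'a::real_normed_vector \<Rightarrow> real"
  assumes "t > 0"
    and U: "\<And>r s. 0 \<le> r \<Longrightarrow> r \<le> t \<Longrightarrow> 0 \<le> s \<Longrightarrow> s \<le> t \<Longrightarrow> x + r *\<^sub>R h + s *\<^sub>R k \<in> U"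
    and f: "smooth_on U f"
  obtains r s where "0 < r" "r < t" "0 < s" "s < t"
    "f (x + t *\<^sub>R h + t *\<^sub>R k) - f (x + t *\<^sub>R h) - f (x + t *\<^sub>R k) + f x = t * t *
      frechet_derivative (\<lambda>y. frechet_derivative f (at y) h) (at (x + r *\<^sub>R h + s *\<^sub>R k)) k"
proof -
  define g where "g y = f (y + t *\<^sub>R k) - f y" for y
  have g: "(g has_derivative (\<lambda>d. frechet_derivative f (at (x + r *\<^sub>R h + t *\<^sub>R k)) d
      - frechet_derivative f (at (x + r *\<^sub>R h)) d)) (at (x + r *\<^sub>R h))"
    if "0 \<le> r" "r \<le> t" for r
  proof -
    have "(f has_derivative frechet_derivative f (at (x + r *\<^sub>R h + s *\<^sub>R k)))
        (at (x + r *\<^sub>R h + s *\<^sub>R k))" if "0 \<le> s" "s \<le> t" for s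
      using U[OF \<open>0 \<le> r\<close> \<open>r \<le> t\<close> that] smooth_on_imp_differentiable[OF f] frechet_derivative_works
      by blast
    \<comment> \<open>The increment \<open>g\<close> involves f on the two opposite sides s = t and
      s = 0 of the parallelogram.\<close>
    from this[of t] this[of 0] \<open>t > 0\<close>
    have f1: "(f has_derivative frechet_derivative f (at (x + r *\<^sub>R h + t *\<^sub>R k)))
        (at (x + r *\<^sub>R h + t *\<^sub>R k))"
      and f0: "(f has_derivative frechet_derivative f (at (x + r *\<^sub>R h))) (at (x + r *\<^sub>R h))"
      by simp_all
    have "((\<lambda>y. y + t *\<^sub>R k) has_derivative (\<lambda>d. d)) (at (x + r *\<^sub>R h))"
      by (auto intro!: derivative_eq_intros)
    from has_derivative_diff[OF has_derivative_compose[OF this f1] f0]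
    show ?thesis unfolding g_def .
  qed
  then have "\<And>r. 0 \<le> r \<Longrightarrow> r \<le> t \<Longrightarrow> g differentiable at (x + r *\<^sub>R h)"
    unfolding differentiable_def by blast
  from mvt_direction[OF \<open>t > 0\<close> this]
  obtain r where r: "0 < r" "r < t"
    and 1: "g (x + t *\<^sub>R h) - g x = t * frechet_derivative g (at (x + r *\<^sub>R h)) h"
    by blast
  have 2: "frechet_derivative g (at (x + r *\<^sub>R h)) h =
      frechet_derivative f (at (x + r *\<^sub>R h + t *\<^sub>R k)) h - frechet_derivative f (at (x + r *\<^sub>R h)) h"
    using frechet_derivative_at[OF g[of r], THEN fun_cong, of h] r by simp
  have "(\<lambda>y. frechet_derivative f (at y) h) differentiable at (x + r *\<^sub>R h + s *\<^sub>R k)"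
    if "0 \<le> s" "s \<le> t" for s
    using smooth_on_imp_differentiable[OF smooth_on_frechet_derivative[OF f]] U r that by simp
  from mvt_direction[OF \<open>t > 0\<close> this]
  obtain s where s: "0 < s" "s < t" and 3: "frechet_derivative f (at (x + r *\<^sub>R h + t *\<^sub>R k)) h
      - frechet_derivative f (at (x + r *\<^sub>R h)) h =
      t * frechet_derivative (\<lambda>y. frechet_derivative f (at y) h) (at (x + r *\<^sub>R h + s *\<^sub>R k)) k"
    by blast
  have "f (x + t *\<^sub>R h + t *\<^sub>R k) - f (x + t *\<^sub>R h) - f (x + t *\<^sub>R k) + f x =
      g (x + t *\<^sub>R h) - g x"
    by (simp add: g_def)
  also have "\<dots> = t * t *
      frechet_derivative (\<lambda>y. frechet_derivative f (at y) h) (at (x + r *\<^sub>R h + s *\<^sub>R k)) k"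
    unfolding 1 2 3 by (simp only: mult.assoc)
  finally show thesis
    by (rule that[OF r s])
qed

text \<open>The second difference is symmetric in \<open>h\<close> and \<open>k\<close>, so the mean value theorem makes the two
  mixed derivatives agree at points arbitrarily near \<open>x\<close>.\<close>

lemma symmetric_second_frechet_derivative:
  fixes f :: "'a::real_normed_vector \<Rightarrow> real"
  assumes "open U" "x \<in> U" "smooth_on U f"
  shows "frechet_derivative (\<lambda>y. frechet_derivative f (at y) h) (at x) k =
    frechet_derivative (\<lambda>y. frechet_derivative f (at y) k) (at x) h"
    (is "?A x = ?B x")
proof (rule ccontr)
  assume ne: "?A x \<noteq> ?B x"
  \<comment> \<open>Half of the gap: two errors below \<open>e\<close> cannot add up to the
    gap.\<close>
  define e where "e = \<bar>?A x - ?B x\<bar> / 2"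
  have "e > 0" using ne by (simp add: e_def)
  have "continuous_on U ?A" "continuous_on U ?B"
    by (rule smooth_on_imp_continuous_on[OF smooth_on_frechet_derivative[OF
          smooth_on_frechet_derivative[OF assms(3)]]])+
  then have "isCont ?A x" "isCont ?B x"
    using assms(1,2) continuous_on_eq_continuous_at by blast+
  with \<open>e > 0\<close> obtain d1 d2 where "d1 > 0" "d2 > 0"
    and A: "\<And>y. dist y x < d1 \<Longrightarrow> \<bar>?A y - ?A x\<bar> < e"
    and B: "\<And>y. dist y x < d2 \<Longrightarrow> \<bar>?B y - ?B x\<bar> < e"
    unfolding continuous_at_eps_delta dist_real_def by metis
  obtain d3 where "d3 > 0" and d3: "ball x d3 \<subseteq> U"
    using assms(1,2) openE by blast
  define d where "d = min d1 (min d2 d3)"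
  have "d > 0" using \<open>d1 > 0\<close> \<open>d2 > 0\<close> \<open>d3 > 0\<close> by (simp add: d_def)
  \<comment> \<open>The summand 1 keeps \<open>N\<close> positive when both directions are zero. The
    choice of \<open>t\<close> below makes t N = d/2, which keeps the parallelogram inside the ball
    of radius \<open>d\<close>.\<close>
  define N where "N = norm h + norm k + 1"
  define t where "t = d / (2 * N)"
  have pos: "N > 0"
    unfolding N_def by (smt (verit) norm_ge_zero)
  with \<open>d > 0\<close> have "t > 0" by (simp add: t_def)
  have near: "dist (x + r *\<^sub>R h + s *\<^sub>R k) x < d"
    if "0 \<le> r" "r \<le> t" "0 \<le> s" "s \<le> t" for r s
  proof -
    have "dist (x + r *\<^sub>R h + s *\<^sub>R k) x \<le> r * norm h + s * norm k"
      using norm_triangle_ineq[of "r *\<^sub>R h" "s *\<^sub>R k"] that by (simp add: dist_norm add.assoc)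
    also have "\<dots> \<le> t * norm h + t * norm k"
      using that by (intro add_mono mult_right_mono) auto
    also have "\<dots> \<le> t * N"
      using \<open>t > 0\<close> by (simp add: N_def algebra_simps)
    also have "\<dots> = d / 2" using pos by (simp add: t_def)
    finally show ?thesis using \<open>d > 0\<close> by simp
  qed
  then have U1: "x + r *\<^sub>R h + s *\<^sub>R k \<in> U"
    if "0 \<le> r" "r \<le> t" "0 \<le> s" "s \<le> t" for r s
    using that d3 by (force simp: d_def dist_commute)
  \<comment> \<open>Exchanging the directions gives the same parallelogram.\<close>
  then have U2: "x + r *\<^sub>R k + s *\<^sub>R h \<in> U"
    if "0 \<le> r" "r \<le> t" "0 \<le> s" "s \<le> t" for r s
    using U1[OF that(3,4,1,2)] by (simp add: algebra_simps)
  obtain r s where rs: "0 < r" "r < t" "0 < s" "s < t"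
    "f (x + t *\<^sub>R h + t *\<^sub>R k) - f (x + t *\<^sub>R h) - f (x + t *\<^sub>R k) + f x =
      t * t * ?A (x + r *\<^sub>R h + s *\<^sub>R k)"
    using second_difference[OF \<open>t > 0\<close> U1 assms(3)] by blast
  obtain r' s' where rs': "0 < r'" "r' < t" "0 < s'" "s' < t"
    "f (x + t *\<^sub>R k + t *\<^sub>R h) - f (x + t *\<^sub>R k) - f (x + t *\<^sub>R h) + f x =
      t * t * ?B (x + r' *\<^sub>R k + s' *\<^sub>R h)"
    using second_difference[OF \<open>t > 0\<close> U2 assms(3)] by blast
  have comm: "x + r' *\<^sub>R k + s' *\<^sub>R h = x + s' *\<^sub>R h + r' *\<^sub>R k"
    "x + t *\<^sub>R k + t *\<^sub>R h = x + t *\<^sub>R h + t *\<^sub>R k"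
    by (simp_all add: add.assoc add.commute[of "_ *\<^sub>R k"])
  have "t * t * ?A (x + r *\<^sub>R h + s *\<^sub>R k) = t * t * ?B (x + s' *\<^sub>R h + r' *\<^sub>R k)"
    using rs(5) rs'(5) unfolding comm by linarith
  then have "?A (x + r *\<^sub>R h + s *\<^sub>R k) = ?B (x + s' *\<^sub>R h + r' *\<^sub>R k)"
    using \<open>t > 0\<close> by simp
  moreover have "\<bar>?A (x + r *\<^sub>R h + s *\<^sub>R k) - ?A x\<bar> < e"
    using near[of r s] rs by (intro A) (simp add: d_def)
  moreover have "\<bar>?B (x + s' *\<^sub>R h + r' *\<^sub>R k) - ?B x\<bar> < e"
    using near[of s' r'] rs' by (intro B) (simp add: d_def)
  ultimately have "\<bar>?A x - ?B x\<bar> < 2 * e" by linarith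
  then show False by (simp add: e_def)
qed

section \<open>Derivatives in the plane\<close>

lemma partial_cong:
  assumes "open U" "q \<in> U" "\<And>x. x \<in> U \<Longrightarrow> f x = g x"
  shows "partial i f q = partial i g q"
  unfolding partial_def using frechet_derivative_cong_open[OF assms] by simp

lemma partial_commute:
  fixes f :: "real^2 \<Rightarrow> real"
  assumes "open U" "smooth_on U f" "q \<in> U"
  shows "partial i (partial j f) q = partial j (partial i f) q"
  using symmetric_second_frechet_derivative[OF assms(1,3,2)] unfolding partial_def[abs_def] by blast

lemma partial_mult:
  fixes f g :: "real^2 \<Rightarrow> real"
  assumes "f differentiable at q" "g differentiable at q"
  shows "partial i (\<lambda>x. f x * g x) q = f q * partial i g q + partial i f q * g q"
  using frechet_derivative_at[OF has_derivative_mult_frechet[OF assms], THEN fun_cong, of "axis i 1"]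
  by (simp add: partial_def)

lemma partial_diff:
  fixes f g :: "real^2 \<Rightarrow> real"
  assumes "f differentiable at q" "g differentiable at q"
  shows "partial i (\<lambda>x. f x - g x) q = partial i f q - partial i g q"
proof -
  have "((\<lambda>x. f x - g x) has_derivative
      (\<lambda>h. frechet_derivative f (at q) h - frechet_derivative g (at q) h)) (at q)"
    using assms by (auto intro!: has_derivative_diff simp flip: frechet_derivative_works)
  from frechet_derivative_at[OF this, THEN fun_cong, of "axis i 1"] show ?thesis
    by (simp add: partial_def)
qed

lemma partial_add:
  fixes f g :: "real^2 \<Rightarrow> real"
  assumes "f differentiable at q" "g differentiable at q"
  shows "partial i (\<lambda>x. f x + g x) q = partial i f q + partial i g q"
proof -
  have "((\<lambda>x. f x + g x) has_derivative
      (\<lambda>h. frechet_derivative f (at q) h + frechet_derivative g (at q) h)) (at q)"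
    using assms by (auto intro!: has_derivative_add simp flip: frechet_derivative_works)
  from frechet_derivative_at[OF this, THEN fun_cong, of "axis i 1"] show ?thesis
    by (simp add: partial_def)
qed

lemma frechet_derivative_eq_partials:
  fixes f :: "real^2 \<Rightarrow> real"
  assumes "f differentiable at q"
  shows "frechet_derivative f (at q) h = h$1 * partial 1 f q + h$2 * partial 2 f q"
proof -
  have lin: "linear (frechet_derivative f (at q))"
    using assms linear_frechet_derivative by blast
  have "h = h$1 *\<^sub>R axis 1 1 + h$2 *\<^sub>R axis 2 1"
    by (simp add: vec_eq_iff forall_2 axis_def)
  then have "frechet_derivative f (at q) h =
      frechet_derivative f (at q) (h$1 *\<^sub>R axis 1 1 + h$2 *\<^sub>R axis 2 1)"
    by simp
  then show ?thesis
    unfolding partial_def using lin by (simp add: linear_add linear_cmul)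
qed

section \<open>Leibniz rules and explicit formulas for derivatives along a vector field\<close>

lemma along_cong:
  assumes "open U" "q \<in> U" "\<And>x. x \<in> U \<Longrightarrow> f x = g x"
  shows "along \<eta> f q = along \<eta> g q"
  unfolding along_def using frechet_derivative_cong_open[OF assms] by simp

lemma along_mult:
  assumes "f differentiable at q" "g differentiable at q"
  shows "along \<eta> (\<lambda>x. f x * g x) q = f q * along \<eta> g q + along \<eta> f q * g q"
  using frechet_derivative_at[OF has_derivative_mult_frechet[OF assms], THEN fun_cong, of "\<eta> q"]
  by (simp add: along_def)

lemma along_add:
  assumes "f differentiable at q" "g differentiable at q"
  shows "along \<eta> (\<lambda>x. f x + g x) q = along \<eta> f q + along \<eta> g q"
proof -
  have "((\<lambda>x. f x + g x) has_derivative
      (\<lambda>h. frechet_derivative f (at q) h + frechet_derivative g (at q) h)) (at q)"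
    using assms by (auto intro!: has_derivative_add simp flip: frechet_derivative_works)
  from frechet_derivative_at[OF this, THEN fun_cong, of "\<eta> q"] show ?thesis
    by (simp add: along_def)
qed

lemma along_null_field:
  assumes "f differentiable at q"
  shows "along (null_field c1 c2) f q = c2 q * partial 1 f q - c1 q * partial 2 f q"
  unfolding along_def null_field_def by (simp add: frechet_derivative_eq_partials[OF assms])

text \<open>The operator has smooth coefficients, so it preserves smoothness. This supplies the
  smoothness assumptions of the iterated Leibniz rules.\<close>

lemma smooth_on_along_null_field:
  assumes "open U" "smooth_on U c1" "smooth_on U c2" "smooth_on U f"
  shows "smooth_on U (along (null_field c1 c2) f)"
proof (rule smooth_on_cong[OF assms(1)])
  show "smooth_on U (\<lambda>q. c2 q * partial 1 f q - c1 q * partial 2 f q)"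
    using assms by (intro smooth_on_diff smooth_on_mult smooth_on_partial)
  show "c2 q * partial 1 f q - c1 q * partial 2 f q = along (null_field c1 c2) f q"
    if "q \<in> U" for q
    using along_null_field smooth_on_imp_differentiable assms(4) that by metis
qed

text \<open>The cross term is the reason why a zero of f alone does not make the second derivative
  of the product a multiple of that of f; \<open>along \<eta> f\<close> has to vanish as
  well.\<close>

lemma along_along_mult:
  assumes "open U" "smooth_on U f" "smooth_on U g"
    "smooth_on U (along \<eta> f)" "smooth_on U (along \<eta> g)" "q \<in> U"
  shows "along \<eta> (along \<eta> (\<lambda>x. f x * g x)) q =
    f q * along \<eta> (along \<eta> g) q + 2 * along \<eta> f q * along \<eta> g q + along \<eta> (along \<eta> f) q * g q"
proof -
  note diff = assms(2-5)[THEN smooth_on_imp_differentiable]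
  have "along \<eta> (along \<eta> (\<lambda>x. f x * g x)) q =
      along \<eta> (\<lambda>x. f x * along \<eta> g x + along \<eta> f x * g x) q"
    using assms diff by (intro along_cong[of U]) (simp_all add: along_mult)
  also have "\<dots> = along \<eta> (\<lambda>x. f x * along \<eta> g x) q + along \<eta> (\<lambda>x. along \<eta> f x * g x) q"
    using assms diff by (intro along_add differentiable_mult) simp_all
  finally show ?thesis
    using assms diff by (simp add: along_mult algebra_simps)
qed

lemma along_along_along_mult:
  assumes "open U" "smooth_on U f" "smooth_on U g"
    and smooth: "\<And>h. smooth_on U h \<Longrightarrow> smooth_on U (along \<eta> h)" and "q \<in> U"
  shows "along \<eta> (along \<eta> (along \<eta> (\<lambda>x. f x * g x))) q =
    f q * along \<eta> (along \<eta> (along \<eta> g)) q + 3 * along \<eta> f q * along \<eta> (along \<eta> g) q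
    + 3 * along \<eta> (along \<eta> f) q * along \<eta> g q + along \<eta> (along \<eta> (along \<eta> f)) q * g q"
proof -
  note diff = assms(2,3)[THEN smooth_on_imp_differentiable]
  note smooth' = assms(2,3)[THEN smooth]
  have sm: "smooth_on U (along \<eta> (\<lambda>x. f x * along \<eta> g x))"
    "smooth_on U (along \<eta> (\<lambda>x. along \<eta> f x * g x))"
    using assms smooth' by (intro smooth smooth_on_mult; simp)+
  \<comment> \<open>The splitting is needed on all of \<open>U\<close>, because it is differentiated
    once more; each summand is then again a second derivative of a product.\<close>
  have "along \<eta> (along \<eta> (\<lambda>x. f x * g x)) x =
      along \<eta> (\<lambda>x. f x * along \<eta> g x) x + along \<eta> (\<lambda>x. along \<eta> f x * g x) x" if "x \<in> U" for x
  proof -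
    have "along \<eta> (along \<eta> (\<lambda>x. f x * g x)) x =
        along \<eta> (\<lambda>x. f x * along \<eta> g x + along \<eta> f x * g x) x"
      using assms that diff by (intro along_cong[of U]) (simp_all add: along_mult)
    then show ?thesis
      using that diff smooth'[THEN smooth_on_imp_differentiable] by (simp add: along_add)
  qed
  then have "along \<eta> (along \<eta> (along \<eta> (\<lambda>x. f x * g x))) q =
      along \<eta> (\<lambda>x. along \<eta> (\<lambda>x. f x * along \<eta> g x) x + along \<eta> (\<lambda>x. along \<eta> f x * g x) x) q"
    using assms by (intro along_cong[of U]) simp_all
  also have "\<dots> = along \<eta> (along \<eta> (\<lambda>x. f x * along \<eta> g x)) q
      + along \<eta> (along \<eta> (\<lambda>x. along \<eta> f x * g x)) q"
    using sm[THEN smooth_on_imp_differentiable] \<open>q \<in> U\<close> by (simp add: along_add)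
  finally show ?thesis
    using assms smooth' by (simp add: along_along_mult smooth algebra_simps)
qed

text \<open>With phi = a_v c1 - a_u c2 the two brackets are phi_v and phi_u, so the right-hand side
  is c1 phi_v - c2 phi_u = -\<eta>phi.\<close>

lemma along_along_null_field:
  assumes U: "open U" and sm: "smooth_on U a" "smooth_on U c1" "smooth_on U c2" and "q \<in> U"
  shows "along (null_field c1 c2) (along (null_field c1 c2) a) q =
    c1 q * (a\<^bsub>vv\<^esub> q * c1 q + a\<^bsub>v\<^esub> q * c1\<^bsub>v\<^esub> q - a\<^bsub>u\<^esub> q * c2\<^bsub>v\<^esub> q - a\<^bsub>uv\<^esub> q * c2 q)
    - c2 q * (a\<^bsub>v\<^esub> q * c1\<^bsub>u\<^esub> q - a\<^bsub>uu\<^esub> q * c2 q - a\<^bsub>u\<^esub> q * c2\<^bsub>u\<^esub> q + a\<^bsub>uv\<^esub> q * c1 q)"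
proof -
  let ?\<eta> = "null_field c1 c2"
  note smd = sm[THEN smooth_on_imp_differentiable, OF \<open>q \<in> U\<close>]
    sm(1)[THEN smooth_on_partial, THEN smooth_on_imp_differentiable, OF \<open>q \<in> U\<close>]
  have "along ?\<eta> (along ?\<eta> a) q = along ?\<eta> (\<lambda>x. c2 x * a\<^bsub>u\<^esub> x - c1 x * a\<^bsub>v\<^esub> x) q"
    by (intro along_cong[OF U \<open>q \<in> U\<close>] along_null_field smooth_on_imp_differentiable[OF sm(1)])
  also have "\<dots> = c2 q * partial 1 (\<lambda>x. c2 x * a\<^bsub>u\<^esub> x - c1 x * a\<^bsub>v\<^esub> x) q
      - c1 q * partial 2 (\<lambda>x. c2 x * a\<^bsub>u\<^esub> x - c1 x * a\<^bsub>v\<^esub> x) q"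
    using smd by (intro along_null_field) auto
  also have "\<dots> = c2 q * (c2 q * a\<^bsub>uu\<^esub> q + c2\<^bsub>u\<^esub> q * a\<^bsub>u\<^esub> q - (c1 q * a\<^bsub>uv\<^esub> q + c1\<^bsub>u\<^esub> q * a\<^bsub>v\<^esub> q))
      - c1 q * (c2 q * a\<^bsub>uv\<^esub> q + c2\<^bsub>v\<^esub> q * a\<^bsub>u\<^esub> q - (c1 q * a\<^bsub>vv\<^esub> q + c1\<^bsub>v\<^esub> q * a\<^bsub>v\<^esub> q))"
    using smd partial_commute[OF U sm(1) \<open>q \<in> U\<close>, of 1 2]
    by (simp add: partial_diff partial_mult)
  finally show ?thesis by (simp add: algebra_simps)
qed

text \<open>This is -\<eta>\<eta>phi for phi = a_v c1 - a_u c2. The five brackets are phi_u, phi_v,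
  phi_uu, phi_vv and phi_uv in this order; the factor 2 before the last one joins the two mixed
  derivatives.\<close>

lemma along_along_along_null_field:
  assumes U: "open U" and sm: "smooth_on U a" "smooth_on U c1" "smooth_on U c2" and q: "q \<in> U"
  shows "along (null_field c1 c2) (along (null_field c1 c2) (along (null_field c1 c2) a)) q = -
    ((c2 q * c2\<^bsub>u\<^esub> q - c1 q * c2\<^bsub>v\<^esub> q) * (a\<^bsub>v\<^esub> q * c1\<^bsub>u\<^esub> q - a\<^bsub>uu\<^esub> q * c2 q - a\<^bsub>u\<^esub> q * c2\<^bsub>u\<^esub> q + a\<^bsub>uv\<^esub> q * c1 q)
    + (c1 q * c1\<^bsub>v\<^esub> q - c2 q * c1\<^bsub>u\<^esub> q) * (a\<^bsub>vv\<^esub> q * c1 q + a\<^bsub>v\<^esub> q * c1\<^bsub>v\<^esub> q - a\<^bsub>u\<^esub> q * c2\<^bsub>v\<^esub> q - a\<^bsub>uv\<^esub> q * c2 q)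
    + (c2 q)\<^sup>2 * (2 * a\<^bsub>uv\<^esub> q * c1\<^bsub>u\<^esub> q + a\<^bsub>v\<^esub> q * c1\<^bsub>uu\<^esub> q - a\<^bsub>uuu\<^esub> q * c2 q - 2 * a\<^bsub>uu\<^esub> q * c2\<^bsub>u\<^esub> q - a\<^bsub>u\<^esub> q * c2\<^bsub>uu\<^esub> q + a\<^bsub>uuv\<^esub> q * c1 q)
    + (c1 q)\<^sup>2 * (a\<^bsub>vvv\<^esub> q * c1 q + 2 * a\<^bsub>vv\<^esub> q * c1\<^bsub>v\<^esub> q + a\<^bsub>v\<^esub> q * c1\<^bsub>vv\<^esub> q - 2 * a\<^bsub>uv\<^esub> q * c2\<^bsub>v\<^esub> q - a\<^bsub>u\<^esub> q * c2\<^bsub>vv\<^esub> q - a\<^bsub>uvv\<^esub> q * c2 q)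
    - 2 * c1 q * c2 q * (a\<^bsub>uvv\<^esub> q * c1 q + a\<^bsub>vv\<^esub> q * c1\<^bsub>u\<^esub> q + a\<^bsub>uv\<^esub> q * c1\<^bsub>v\<^esub> q + a\<^bsub>v\<^esub> q * c1\<^bsub>uv\<^esub> q
        - a\<^bsub>uu\<^esub> q * c2\<^bsub>v\<^esub> q - a\<^bsub>u\<^esub> q * c2\<^bsub>uv\<^esub> q - a\<^bsub>uuv\<^esub> q * c2 q - a\<^bsub>uv\<^esub> q * c2\<^bsub>u\<^esub> q))"
proof -
  let ?\<eta> = "null_field c1 c2"
  let ?P = "\<lambda>x. a\<^bsub>v\<^esub> x * c1\<^bsub>u\<^esub> x - a\<^bsub>uu\<^esub> x * c2 x - a\<^bsub>u\<^esub> x * c2\<^bsub>u\<^esub> x + a\<^bsub>uv\<^esub> x * c1 x"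
  let ?Q = "\<lambda>x. a\<^bsub>vv\<^esub> x * c1 x + a\<^bsub>v\<^esub> x * c1\<^bsub>v\<^esub> x - a\<^bsub>u\<^esub> x * c2\<^bsub>v\<^esub> x - a\<^bsub>uv\<^esub> x * c2 x"
  note sm1 = sm[THEN smooth_on_partial]
  note diff = sm[THEN smooth_on_imp_differentiable, OF q]
    sm1[THEN smooth_on_imp_differentiable, OF q]
    sm1[THEN smooth_on_partial, THEN smooth_on_imp_differentiable, OF q]
  note commute2 = sm[THEN partial_commute[OF U], OF q, of 1 2]
  \<comment> \<open>Moving the derivative by u innermost takes two exchanges. The second takes place
    under a further derivative and must therefore hold on \<open>U\<close>.\<close>
  have "partial 1 (partial 2 (partial 2 a)) q = partial 2 (partial 1 (partial 2 a)) q"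
    by (rule partial_commute[OF U sm1(1) q])
  also have "\<dots> = a\<^bsub>uvv\<^esub> q"
    by (rule partial_cong[OF U q]) (rule partial_commute[OF U sm(1)])
  finally have commute3: "partial 1 (partial 2 (partial 2 a)) q = a\<^bsub>uvv\<^esub> q"
    "partial 1 (partial 2 (partial 1 a)) q = a\<^bsub>uuv\<^esub> q"
    using partial_commute[OF U sm1(1) q] by simp_all
  have P: "?P differentiable at q" and Q: "?Q differentiable at q"
    by (intro differentiable_add differentiable_diff differentiable_mult diff)+
  \<comment> \<open>\<open>?P\<close> and \<open>?Q\<close> are phi_u and phi_v; keeping them folded
    leaves a single product rule at this stage.\<close>
  have "along ?\<eta> (along ?\<eta> (along ?\<eta> a)) q = along ?\<eta> (\<lambda>x. c1 x * ?Q x - c2 x * ?P x) q"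
    using along_along_null_field[OF U sm] by (intro along_cong[OF U q]) simp
  also have "\<dots> = c2 q * partial 1 (\<lambda>x. c1 x * ?Q x - c2 x * ?P x) q
      - c1 q * partial 2 (\<lambda>x. c1 x * ?Q x - c2 x * ?P x) q"
    by (intro along_null_field differentiable_diff differentiable_mult P Q diff)
  also have "\<dots> = c2 q * (c1 q * ?Q\<^bsub>u\<^esub> q + c1\<^bsub>u\<^esub> q * ?Q q - (c2 q * ?P\<^bsub>u\<^esub> q + c2\<^bsub>u\<^esub> q * ?P q))
      - c1 q * (c1 q * ?Q\<^bsub>v\<^esub> q + c1\<^bsub>v\<^esub> q * ?Q q - (c2 q * ?P\<^bsub>v\<^esub> q + c2\<^bsub>v\<^esub> q * ?P q))"
    using P Q diff by (simp only: partial_diff partial_mult differentiable_mult)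
  finally have *: "along ?\<eta> (along ?\<eta> (along ?\<eta> a)) q = \<dots>" .
  have dP: "partial i ?P q = a\<^bsub>v\<^esub> q * partial i (c1\<^bsub>u\<^esub>) q + partial i (a\<^bsub>v\<^esub>) q * c1\<^bsub>u\<^esub> q
      - (a\<^bsub>uu\<^esub> q * partial i c2 q + partial i (a\<^bsub>uu\<^esub>) q * c2 q)
      - (a\<^bsub>u\<^esub> q * partial i (c2\<^bsub>u\<^esub>) q + partial i (a\<^bsub>u\<^esub>) q * c2\<^bsub>u\<^esub> q)
      + (a\<^bsub>uv\<^esub> q * partial i c1 q + partial i (a\<^bsub>uv\<^esub>) q * c1 q)" for i
    using diff by (simp add: partial_diff partial_add partial_mult differentiable_add)
  have dQ: "partial i ?Q q = a\<^bsub>vv\<^esub> q * partial i c1 q + partial i (a\<^bsub>vv\<^esub>) q * c1 q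
      + (a\<^bsub>v\<^esub> q * partial i (c1\<^bsub>v\<^esub>) q + partial i (a\<^bsub>v\<^esub>) q * c1\<^bsub>v\<^esub> q)
      - (a\<^bsub>u\<^esub> q * partial i (c2\<^bsub>v\<^esub>) q + partial i (a\<^bsub>u\<^esub>) q * c2\<^bsub>v\<^esub> q)
      - (a\<^bsub>uv\<^esub> q * partial i c2 q + partial i (a\<^bsub>uv\<^esub>) q * c2 q)" for i
    using diff by (simp add: partial_diff partial_add partial_mult differentiable_add)
  show ?thesis
    unfolding * dP dQ commute2 commute3 by (simp add: algebra_simps power2_eq_square)
qed

text \<open>Of the four terms of the Leibniz rule, three contain f or one of its first derivatives.
  At a degenerate point this makes the Hessian of the area density a multiple of that of
  \<open>a1\<close>.\<close>

lemma partial_partial_mult_zero: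
  fixes f g :: "real^2 \<Rightarrow> real"
  assumes U: "open U" and f: "smooth_on U f" and g: "smooth_on U g" and q: "q \<in> U"
    and "f q = 0" "partial i f q = 0" "partial j f q = 0"
  shows "partial j (partial i (\<lambda>x. f x * g x)) q = partial j (partial i f) q * g q"
proof -
  note diff = f[THEN smooth_on_imp_differentiable] g[THEN smooth_on_imp_differentiable]
    f[THEN smooth_on_partial, THEN smooth_on_imp_differentiable]
    g[THEN smooth_on_partial, THEN smooth_on_imp_differentiable]
  have "partial j (partial i (\<lambda>x. f x * g x)) q =
      partial j (\<lambda>x. f x * partial i g x + partial i f x * g x) q"
    using diff by (intro partial_cong[OF U q] partial_mult) simp_all
  then show ?thesis
    using diff q assms by (simp add: partial_add partial_mult)
qed

section \<open>The area density of a lightcone framed surface\<close>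

text \<open>Pairing with the standard basis reads off the coordinates, the first one with a minus
  sign because of the signature.\<close>

lemma wedge_eq:
  "wedge x y = vector [x$3 * y$2 - x$2 * y$3, x$3 * y$1 - x$1 * y$3, x$1 * y$2 - x$2 * y$1]"
  using lprod_wedge[of "vector [1,0,0]" x y] lprod_wedge[of "vector [0,1,0]" x y]
    lprod_wedge[of "vector [0,0,1]" x y]
  by (simp add: lprod_def det_3 vec_eq_iff forall_3 algebra_simps)

text \<open>The Lagrange identity, with the sign opposite to the Euclidean one.\<close>

lemma lprod_wedge_self:
  "lprod (wedge x y) (wedge x y) = (lprod x y)\<^sup>2 - lprod x x * lprod y y"
  by (simp add: wedge_eq lprod_def power2_eq_square algebra_simps)

lemma lprod_commute: "lprod x y = lprod y x"
  by (simp add: lprod_def)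

lemma lprod_add_left: "lprod (x + y) z = lprod x z + lprod y z"
  by (simp add: lprod_def algebra_simps)

lemma lprod_add_right: "lprod x (y + z) = lprod x y + lprod x z"
  by (simp add: lprod_def algebra_simps)

lemma lprod_scaleR_left: "lprod (r *\<^sub>R x) y = r * lprod x y"
  by (simp add: lprod_def algebra_simps)

lemma lprod_scaleR_right: "lprod x (r *\<^sub>R y) = r * lprod x y"
  by (simp add: lprod_def algebra_simps)

text \<open>A determinant with a repeated row makes m orthogonal to v and w. The Lagrange identity
  gives the norm of m: (1/4) ((-2)^2 - 0) = 1, which explains the factor -1/2 up to sign.\<close>

lemma lprod_lightcone_frame:
  assumes "(v q, w q) \<in> Delta4"
  shows "lprod (v q) (v q) = 0" "lprod (w q) (w q) = 0"
    "lprod (v q) (w q) = -2" "lprod (w q) (v q) = -2"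
    "lprod (v q) (unit_m v w q) = 0" "lprod (unit_m v w q) (v q) = 0"
    "lprod (w q) (unit_m v w q) = 0" "lprod (unit_m v w q) (w q) = 0"
    "lprod (unit_m v w q) (unit_m v w q) = 1"
proof -
  show vw: "lprod (v q) (v q) = 0" "lprod (w q) (w q) = 0" "lprod (v q) (w q) = -2"
    using assms by (auto simp: Delta4_def LC_def lightlike_def)
  then show "lprod (w q) (v q) = -2"
    using lprod_commute by metis
  show m: "lprod (v q) (unit_m v w q) = 0" "lprod (w q) (unit_m v w q) = 0"
    unfolding unit_m_def lprod_scaleR_right lprod_wedge by (simp_all add: det_3)
  then show "lprod (unit_m v w q) (v q) = 0" "lprod (unit_m v w q) (w q) = 0"
    using lprod_commute by metis+
  show "lprod (unit_m v w q) (unit_m v w q) = 1"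
    unfolding unit_m_def lprod_scaleR_left lprod_scaleR_right lprod_wedge_self
    by (simp add: vw)
qed

text \<open>In the frame, E = c1^2 - 4 a1 b1, F = c1 c2 and G = c2^2, so the terms c1^2 c2^2 cancel.
  The -4 is twice the product -2 of v and w.\<close>

lemma discriminant_eq:
  assumes "lightcone_framed_surface U X v w"
    and "basic_invariants U X v w 1 a1 b1 c1 e1 f1 g1"
    and "basic_invariants U X v w 2 a2 b2 c2 e2 f2 g2"
    and "a2 q = 0" "b2 q = 0" "q \<in> U"
  shows "discriminant X q = (c2 q)\<^sup>2 * signed_area_density a1 b1 q"
proof -
  have "(v q, w q) \<in> Delta4"
    using assms(1,6) by (simp add: lightcone_framed_surface_def)
  note frame = lprod_lightcone_frame[where v = v and w = w, OF this]
  have Xu: "partial 1 X q = a1 q *\<^sub>R v q + b1 q *\<^sub>R w q + c1 q *\<^sub>R unit_m v w q"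
    and Xv: "partial 2 X q = c2 q *\<^sub>R unit_m v w q"
    using assms(2-6) by (simp_all add: basic_invariants_def)
  show ?thesis
    unfolding discriminant_def fundE_def fundF_def fundG_def Xu Xv signed_area_density_def
    by (simp add: lprod_add_left lprod_add_right lprod_scaleR_left lprod_scaleR_right frame
        algebra_simps power2_eq_square)
qed

section \<open>The criteria in terms of the basic invariants\<close>

theorem theorem3p8:
  fixes U :: "(real^2) set" and p :: "real^2"
    and X v w :: "real^2 \<Rightarrow> real^3"
    and a1 b1 c1 e1 f1 g1 a2 b2 c2 e2 f2 g2 :: "real^2 \<Rightarrow> real"
  assumes "open U" and "connected U"
    and "lightcone_framed_surface U X v w"
    and "basic_invariants U X v w 1 a1 b1 c1 e1 f1 g1"
    and "basic_invariants U X v w 2 a2 b2 c2 e2 f2 g2"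
    and "\<forall>q\<in>U. a2 q = 0 \<and> b2 q = 0"
    and "p \<in> U" and "lightlike_point X p"
    and "a1 p = 0" and "b1 p \<noteq> 0" and "c2 p \<noteq> 0"
  shows
    "(nondegenerate_lightlike_point X p \<longrightarrow>
      a1 p = 0 \<and> (a1\<^bsub>u\<^esub> p)\<^sup>2 + (a1\<^bsub>v\<^esub> p)\<^sup>2 \<noteq> 0 \<and>
      (cuspidal_edge_kind X (signed_area_density a1 b1) (null_field c1 c2) p \<longleftrightarrow>
        a1\<^bsub>v\<^esub> p * c1 p - a1\<^bsub>u\<^esub> p * c2 p \<noteq> 0) \<and>
      (swallowtail_kind X (signed_area_density a1 b1) (null_field c1 c2) p \<longleftrightarrow>
        a1\<^bsub>v\<^esub> p * c1 p - a1\<^bsub>u\<^esub> p * c2 p = 0 \<and>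
        (c2 p * (a1\<^bsub>v\<^esub> p * c1\<^bsub>u\<^esub> p - a1\<^bsub>uu\<^esub> p * c2 p - a1\<^bsub>u\<^esub> p * c2\<^bsub>u\<^esub> p + a1\<^bsub>uv\<^esub> p * c1 p)
        - c1 p * (a1\<^bsub>vv\<^esub> p * c1 p + a1\<^bsub>v\<^esub> p * c1\<^bsub>v\<^esub> p - a1\<^bsub>u\<^esub> p * c2\<^bsub>v\<^esub> p - a1\<^bsub>uv\<^esub> p * c2 p)) \<noteq> 0) \<and>
      (cuspidal_butterfly_kind X (signed_area_density a1 b1) (null_field c1 c2) p \<longleftrightarrow>
        a1\<^bsub>v\<^esub> p * c1 p - a1\<^bsub>u\<^esub> p * c2 p = 0 \<and>
        (c2 p * (a1\<^bsub>v\<^esub> p * c1\<^bsub>u\<^esub> p - a1\<^bsub>uu\<^esub> p * c2 p - a1\<^bsub>u\<^esub> p * c2\<^bsub>u\<^esub> p + a1\<^bsub>uv\<^esub> p * c1 p)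
        - c1 p * (a1\<^bsub>vv\<^esub> p * c1 p + a1\<^bsub>v\<^esub> p * c1\<^bsub>v\<^esub> p - a1\<^bsub>u\<^esub> p * c2\<^bsub>v\<^esub> p - a1\<^bsub>uv\<^esub> p * c2 p)) = 0 \<and>
        ((c2 p * c2\<^bsub>u\<^esub> p - c1 p * c2\<^bsub>v\<^esub> p) * (a1\<^bsub>v\<^esub> p * c1\<^bsub>u\<^esub> p - a1\<^bsub>uu\<^esub> p * c2 p - a1\<^bsub>u\<^esub> p * c2\<^bsub>u\<^esub> p + a1\<^bsub>uv\<^esub> p * c1 p)
        + (c1 p * c1\<^bsub>v\<^esub> p - c2 p * c1\<^bsub>u\<^esub> p) * (a1\<^bsub>vv\<^esub> p * c1 p + a1\<^bsub>v\<^esub> p * c1\<^bsub>v\<^esub> p - a1\<^bsub>u\<^esub> p * c2\<^bsub>v\<^esub> p - a1\<^bsub>uv\<^esub> p * c2 p)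
        + (c2 p)\<^sup>2 * (2 * a1\<^bsub>uv\<^esub> p * c1\<^bsub>u\<^esub> p + a1\<^bsub>v\<^esub> p * c1\<^bsub>uu\<^esub> p - a1\<^bsub>uuu\<^esub> p * c2 p - 2 * a1\<^bsub>uu\<^esub> p * c2\<^bsub>u\<^esub> p - a1\<^bsub>u\<^esub> p * c2\<^bsub>uu\<^esub> p + a1\<^bsub>uuv\<^esub> p * c1 p)
        + (c1 p)\<^sup>2 * (a1\<^bsub>vvv\<^esub> p * c1 p + 2 * a1\<^bsub>vv\<^esub> p * c1\<^bsub>v\<^esub> p + a1\<^bsub>v\<^esub> p * c1\<^bsub>vv\<^esub> p - 2 * a1\<^bsub>uv\<^esub> p * c2\<^bsub>v\<^esub> p - a1\<^bsub>u\<^esub> p * c2\<^bsub>vv\<^esub> p - a1\<^bsub>uvv\<^esub> p * c2 p)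
        - 2 * c1 p * c2 p * (a1\<^bsub>uvv\<^esub> p * c1 p + a1\<^bsub>vv\<^esub> p * c1\<^bsub>u\<^esub> p + a1\<^bsub>uv\<^esub> p * c1\<^bsub>v\<^esub> p + a1\<^bsub>v\<^esub> p * c1\<^bsub>uv\<^esub> p
            - a1\<^bsub>uu\<^esub> p * c2\<^bsub>v\<^esub> p - a1\<^bsub>u\<^esub> p * c2\<^bsub>uv\<^esub> p - a1\<^bsub>uuv\<^esub> p * c2 p - a1\<^bsub>uv\<^esub> p * c2\<^bsub>u\<^esub> p)) \<noteq> 0))
    \<and>
     (degenerate_lightlike_point X p \<longrightarrow>
      a1 p = 0 \<and> a1\<^bsub>u\<^esub> p = 0 \<and> a1\<^bsub>v\<^esub> p = 0 \<and>
      (cuspidal_lips_kind X (signed_area_density a1 b1) p \<longleftrightarrow>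
        a1\<^bsub>uu\<^esub> p * a1\<^bsub>vv\<^esub> p - (a1\<^bsub>uv\<^esub> p)\<^sup>2 > 0) \<and>
      (cuspidal_beaks_kind X (signed_area_density a1 b1) (null_field c1 c2) p \<longleftrightarrow>
        a1\<^bsub>uu\<^esub> p * a1\<^bsub>vv\<^esub> p - (a1\<^bsub>uv\<^esub> p)\<^sup>2 < 0 \<and>
        2 * a1\<^bsub>uv\<^esub> p * c1 p * c2 p - a1\<^bsub>uu\<^esub> p * (c2 p)\<^sup>2 - a1\<^bsub>vv\<^esub> p * (c1 p)\<^sup>2 \<noteq> 0))"
proof -
  note U = \<open>open U\<close> and p = \<open>p \<in> U\<close>
  have a: "smooth_on U a1" and b: "smooth_on U b1" and c1: "smooth_on U c1"
    and c2: "smooth_on U c2"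
    using assms(4,5) by (simp_all add: basic_invariants_def)
  let ?l = "signed_area_density a1 b1" and ?\<eta> = "null_field c1 c2"
  \<comment> \<open>The cofactor of \<open>a1\<close> in the area density; it absorbs the constant
    and is nonzero at \<open>p\<close>.\<close>
  define h where "h q = -4 * b1 q" for q
  have l: "?l = (\<lambda>q. a1 q * h q)"
    by (auto simp: signed_area_density_def h_def)
  have h: "smooth_on U h"
    unfolding h_def by (intro smooth_on_mult[OF U smooth_on_const b])
  have hp: "h p \<noteq> 0"
    using \<open>b1 p \<noteq> 0\<close> by (simp add: h_def)
  have Da: "a1 differentiable at p"
    using a p by (rule smooth_on_imp_differentiable)

  have "frechet_derivative (discriminant X) (at p) =
      frechet_derivative (\<lambda>q. a1 q * (c2 q * c2 q * h q)) (at p)"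
    using discriminant_eq[OF assms(3-5)] assms(6)
    by (intro frechet_derivative_cong_open[OF U p]) (simp add: l power2_eq_square)
  \<comment> \<open>The derivative of the cofactor is multiplied by \<open>a1 p = 0\<close>, so
    degeneracy at \<open>p\<close> means that the differential of \<open>a1\<close> vanishes
    there.\<close>
  also have "\<dots> = (\<lambda>d. frechet_derivative a1 (at p) d * (c2 p * c2 p * h p))"
    using frechet_derivative_at[OF has_derivative_mult_frechet[OF Da
          smooth_on_imp_differentiable[OF smooth_on_mult[OF U smooth_on_mult[OF U c2 c2] h] p]]]
      \<open>a1 p = 0\<close> by simp
  finally have "frechet_derivative (discriminant X) (at p) = (\<lambda>d. 0) \<longleftrightarrow>
      frechet_derivative a1 (at p) = (\<lambda>d. 0)"
    using \<open>c2 p \<noteq> 0\<close> hp by (auto simp: fun_eq_iff)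
  also have "\<dots> \<longleftrightarrow> a1\<^bsub>u\<^esub> p = 0 \<and> a1\<^bsub>v\<^esub> p = 0"
  proof
    show "a1\<^bsub>u\<^esub> p = 0 \<and> a1\<^bsub>v\<^esub> p = 0" if "frechet_derivative a1 (at p) = (\<lambda>d. 0)"
      using that by (simp add: partial_def)
    show "frechet_derivative a1 (at p) = (\<lambda>d. 0)" if "a1\<^bsub>u\<^esub> p = 0 \<and> a1\<^bsub>v\<^esub> p = 0"
      using that by (auto simp: fun_eq_iff frechet_derivative_eq_partials[OF Da])
  qed
  finally have degenerate: "degenerate_lightlike_point X p \<longleftrightarrow> a1\<^bsub>u\<^esub> p = 0 \<and> a1\<^bsub>v\<^esub> p = 0"
    and nondegenerate: "nondegenerate_lightlike_point X p \<longleftrightarrow> \<not> (a1\<^bsub>u\<^esub> p = 0 \<and> a1\<^bsub>v\<^esub> p = 0)"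
    using \<open>lightlike_point X p\<close>
    by (simp_all add: degenerate_lightlike_point_def nondegenerate_lightlike_point_def)

  note along_smooth = smooth_on_along_null_field[OF U c1 c2]
  have along1: "along ?\<eta> ?l p = along ?\<eta> a1 p * h p"
    unfolding l using \<open>a1 p = 0\<close> Da smooth_on_imp_differentiable[OF h p] by (simp add: along_mult)
  \<comment> \<open>From the second order on, the rescaling is conditional: the lower derivatives
    must vanish to remove the cross terms. The swallowtail and butterfly kinds impose exactly these
    conditions.\<close>
  have along2: "along ?\<eta> (along ?\<eta> ?l) p = along ?\<eta> (along ?\<eta> a1) p * h p"
    if "along ?\<eta> a1 p = 0"
    unfolding l using along_along_mult[OF U a h along_smooth[OF a] along_smooth[OF h] p]
      that \<open>a1 p = 0\<close> by simp
  have along3: "along ?\<eta> (along ?\<eta> (along ?\<eta> ?l)) p = along ?\<eta> (along ?\<eta> (along ?\<eta> a1)) p * h p"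
    if "along ?\<eta> a1 p = 0" "along ?\<eta> (along ?\<eta> a1) p = 0"
    unfolding l using along_along_along_mult[OF U a h along_smooth p] that \<open>a1 p = 0\<close> by simp
  note alongs = along_null_field[OF Da, of c1 c2] along_along_null_field[OF U a c1 c2 p]
    along_along_along_null_field[OF U a c1 c2 p]

  have edge: "along ?\<eta> ?l p \<noteq> 0 \<longleftrightarrow> a1\<^bsub>v\<^esub> p * c1 p - a1\<^bsub>u\<^esub> p * c2 p \<noteq> 0"
    unfolding along1 alongs using hp by (auto simp: algebra_simps)
  have swallowtail: "along ?\<eta> (along ?\<eta> ?l) p \<noteq> 0 \<longleftrightarrow>
      c2 p * (a1\<^bsub>v\<^esub> p * c1\<^bsub>u\<^esub> p - a1\<^bsub>uu\<^esub> p * c2 p - a1\<^bsub>u\<^esub> p * c2\<^bsub>u\<^esub> p + a1\<^bsub>uv\<^esub> p * c1 p)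
      - c1 p * (a1\<^bsub>vv\<^esub> p * c1 p + a1\<^bsub>v\<^esub> p * c1\<^bsub>v\<^esub> p - a1\<^bsub>u\<^esub> p * c2\<^bsub>v\<^esub> p - a1\<^bsub>uv\<^esub> p * c2 p) \<noteq> 0"
    if "along ?\<eta> ?l p = 0"
  proof -
    \<comment> \<open>The condition on the area density passes to \<open>a1\<close>, because the
      factor \<open>h p\<close> can be cancelled.\<close>
    have "along ?\<eta> a1 p = 0" using that hp by (simp add: along1)
    then show ?thesis unfolding along2[OF \<open>along ?\<eta> a1 p = 0\<close>] alongs(2) using hp by auto
  qed
  have butterfly: "along ?\<eta> (along ?\<eta> (along ?\<eta> ?l)) p \<noteq> 0 \<longleftrightarrow>
      along ?\<eta> (along ?\<eta> (along ?\<eta> a1)) p \<noteq> 0"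
    if "along ?\<eta> ?l p = 0" "along ?\<eta> (along ?\<eta> ?l) p = 0"
    using that hp by (simp add: along1 along2 along3)

  \<comment> \<open>The Hessian matrix is scaled by \<open>h p\<close>, hence its determinant by the
    square, and the sign survives whatever the sign of \<open>b1 p\<close>.\<close>
  have hessian: "det (hessian ?l p) = (h p)\<^sup>2 * (a1\<^bsub>uu\<^esub> p * a1\<^bsub>vv\<^esub> p - (a1\<^bsub>uv\<^esub> p)\<^sup>2)"
    if "a1\<^bsub>u\<^esub> p = 0" "a1\<^bsub>v\<^esub> p = 0"
    using that partial_commute[OF U a p, of 1 2]
      partial_partial_mult_zero[OF U a h p \<open>a1 p = 0\<close>]
    by (simp add: det_2 hessian_def l power2_eq_square algebra_simps)
  have beaks: "along ?\<eta> (along ?\<eta> ?l) p \<noteq> 0 \<longleftrightarrow>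
      2 * a1\<^bsub>uv\<^esub> p * c1 p * c2 p - a1\<^bsub>uu\<^esub> p * (c2 p)\<^sup>2 - a1\<^bsub>vv\<^esub> p * (c1 p)\<^sup>2 \<noteq> 0"
    if "a1\<^bsub>u\<^esub> p = 0" "a1\<^bsub>v\<^esub> p = 0"
  proof -
    \<comment> \<open>At a degenerate point the first derivative along \<eta> vanishes
      automatically. The swallowtail expression therefore applies, and with a_u = a_v = 0 only its
      second derivatives of \<open>a1\<close> remain.\<close>
    have "along ?\<eta> ?l p = 0" using that by (simp add: along1 alongs(1))
    from swallowtail[OF this] show ?thesis
      using that by (simp add: algebra_simps power2_eq_square)
  qed

  show ?thesis
    (is "(_ \<longrightarrow> _ \<and> _ \<and> (_ \<longleftrightarrow> ?e \<noteq> 0) \<and> (_ \<longleftrightarrow> _ \<and> ?s \<noteq> 0) \<and> (_ \<longleftrightarrow> _ \<and> _ \<and> ?b \<noteq> 0)) \<and> _")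
  proof (intro conjI impI)
    assume nd: "nondegenerate_lightlike_point X p"
    then show "(a1\<^bsub>u\<^esub> p)\<^sup>2 + (a1\<^bsub>v\<^esub> p)\<^sup>2 \<noteq> 0"
      by (simp add: nondegenerate sum_power2_eq_zero_iff)
    show "cuspidal_edge_kind X ?l ?\<eta> p \<longleftrightarrow> ?e \<noteq> 0"
      unfolding cuspidal_edge_kind_def using nd edge by blast
    show "swallowtail_kind X ?l ?\<eta> p \<longleftrightarrow> ?e = 0 \<and> ?s \<noteq> 0"
      unfolding swallowtail_kind_def using nd edge swallowtail by blast
    \<comment> \<open>The third iterate is exactly the negative of \<open>?b\<close>.\<close>
    have "along ?\<eta> (along ?\<eta> (along ?\<eta> a1)) p \<noteq> 0 \<longleftrightarrow> ?b \<noteq> 0"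
      unfolding alongs(3) neg_equal_0_iff_equal ..
    then show "cuspidal_butterfly_kind X ?l ?\<eta> p \<longleftrightarrow> ?e = 0 \<and> ?s = 0 \<and> ?b \<noteq> 0"
      unfolding cuspidal_butterfly_kind_def using nd edge swallowtail butterfly by blast
  next
    assume dg: "degenerate_lightlike_point X p"
    then show zero: "a1\<^bsub>u\<^esub> p = 0" "a1\<^bsub>v\<^esub> p = 0"
      by (simp_all add: degenerate)
    note det = hessian[OF zero]
    have "(h p)\<^sup>2 > 0" using hp by simp
    then show "cuspidal_lips_kind X ?l p \<longleftrightarrow> a1\<^bsub>uu\<^esub> p * a1\<^bsub>vv\<^esub> p - (a1\<^bsub>uv\<^esub> p)\<^sup>2 > 0"
      unfolding cuspidal_lips_kind_def det using dg by (auto simp: zero_less_mult_iff)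
    show "cuspidal_beaks_kind X ?l ?\<eta> p \<longleftrightarrow>
        a1\<^bsub>uu\<^esub> p * a1\<^bsub>vv\<^esub> p - (a1\<^bsub>uv\<^esub> p)\<^sup>2 < 0 \<and>
        2 * a1\<^bsub>uv\<^esub> p * c1 p * c2 p - a1\<^bsub>uu\<^esub> p * (c2 p)\<^sup>2 - a1\<^bsub>vv\<^esub> p * (c1 p)\<^sup>2 \<noteq> 0"
      unfolding cuspidal_beaks_kind_def det
      using dg beaks[OF zero] \<open>(h p)\<^sup>2 > 0\<close> by (auto simp: mult_less_0_iff)
  qed (use \<open>a1 p = 0\<close> in simp_all)
qed

end
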